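(* Let $k,n\ge1$ be integers and let $\mathcal{V}\subseteq\{0,1,\dots,k-1\}^n\subseteq\mathbb{R}^n$ be a finite point set. Then $\mathcal{V}$ is extremal if and only if there is a finite family $\mathcal{G}\subseteq\mathbb{R}[x_1,\dots,x_n]$ of degree dominated polynomials that forms a universal Gröbner basis of $I(\mathcal{V})$.
   Context: $I(\mathcal{V})\subseteq\mathbb{R}[x_1,\dots,x_n]$ is the ideal of polynomials vanishing on every point of $\mathcal{V}$. A term order is a total order on monomials with $1$ minimal and compatible with multiplication by monomials; the leading monomial $\mathrm{lm}(f)$ of a nonzero $f$ is its largest monomial with nonzero coefficient; a standard monomial of an ideal $I$ is a monomial that is not the leading monomial of any nonzero $f\in I$, and $\mathrm{Sm}(I)$ is their set. For an ordering $x_{i_1}\succ\dots\succ x_{i_n}$ of the variables, the lexicographic order is: $x^{\mathbf w}\prec x^{\mathbf u}$ iff for the smallest $j$ with $w_{i_j}\ne u_{i_j}$ one has $w_{i_j}<u_{i_j}$. $\mathcal{V}$ is extremal if $\mathrm{Sm}(I(\mathcal{V}))$ is the same for every lexicographic order. A finite subset $\mathbb{G}\subseteq I$ is a Gröbner basis of $I$ w.r.t. a term order if for every nonzero $f\in I$ some $g\in\mathbb{G}$ has $\mathrm{lm}(g)$ dividing $\mathrm{lm}(f)$; it is a universal Gröbner basis if it is a Gröbner basis for every term order. A polynomial is degree dominated with dominating term $x^{\mathbf w}$ if it has the form $x^{\mathbf w}+\sum_{i=1}^{\ell}\alpha_i x^{\mathbf v_i}$ where for every $i$, $x^{\mathbf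 v_i}\neq x^{\mathbf w}$ and $x^{\mathbf v_i}$ divides $x^{\mathbf w}$. *)

theory Defs
  imports "HOL-Analysis.Analysis" "HOL-Library.Poly_Mapping"
begin

text \<open>
  The variables \<open>x\<^sub>i\<close> are indexed by a finite type \<open>'n\<close>.  A monomial \<open>x\<^sup>w\<close> is represented by its
  exponent vector \<open>w\<close>, so that the product of monomials is addition of exponents and the
  monomial 1 is \<open>0\<close>.
\<close>

type_synonym 'n monomial = "'n \<Rightarrow>\<^sub>0 nat"
type_synonym 'n polynomial = "'n monomial \<Rightarrow>\<^sub>0 real"

definition eval_monomial :: "'n::finite monomial \<Rightarrow> real ^ 'n \<Rightarrow> real" where
  "eval_monomial w x = (\<Prod>i\<in>UNIV. x $ i ^ Poly_Mapping.lookup w i)"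

definition eval_polynomial :: "'n::finite polynomial \<Rightarrow> real ^ 'n \<Rightarrow> real" where
  "eval_polynomial f x =
    (\<Sum>w\<in>Poly_Mapping.keys f. Poly_Mapping.lookup f w * eval_monomial w x)"

definition vanishing_ideal :: "(real ^ 'n) set \<Rightarrow> 'n::finite polynomial set" where
  "vanishing_ideal V = {f. \<forall>x\<in>V. eval_polynomial f x = 0}"

text \<open>
  The class instance \<open>\<le>\<close> on \<open>'n \<Rightarrow>\<^sub>0 nat\<close> is lexicographic and not divisibility of monomials.
\<close>

definition monomial_dvd :: "'n monomial \<Rightarrow> 'n monomial \<Rightarrow> bool" where
  "monomial_dvd v w \<longleftrightarrow> (\<exists>c. w = v + c)"

text \<open>Orders are reflexive relations: \<open>(v, w) \<in> r\<close> means that \<open>x\<^sup>v\<close> is at most \<open>x\<^sup>w\<close>.\<close>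

definition term_order :: "'n monomial rel \<Rightarrow> bool" where
  "term_order r \<longleftrightarrow> linear_order r \<and> (\<forall>w. (0, w) \<in> r) \<and>
    (\<forall>v w c. (v, w) \<in> r \<longrightarrow> (v + c, w + c) \<in> r)"

text \<open>Meaningful only for \<open>f \<noteq> 0\<close> and a total order \<open>r\<close>.\<close>

definition lm :: "'n monomial rel \<Rightarrow> 'n polynomial \<Rightarrow> 'n monomial" where
  "lm r f = (THE w. w \<in> Poly_Mapping.keys f \<and> (\<forall>v\<in>Poly_Mapping.keys f. (v, w) \<in> r))"

definition Sm :: "'n monomial rel \<Rightarrow> 'n polynomial set \<Rightarrow> 'n monomial set" where
  "Sm r I = {w. \<not> (\<exists>f\<in>I. f \<noteq> 0 \<and> lm r f = w)}"

text \<open>An ordering of the variables is listed from the largest variable to the smallest.\<close>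

definition variable_ordering :: "'n::finite list \<Rightarrow> bool" where
  "variable_ordering xs \<longleftrightarrow> distinct xs \<and> set xs = UNIV"

definition lex_order :: "'n list \<Rightarrow> 'n monomial rel" where
  "lex_order xs = {(w, u). w = u \<or>
    (\<exists>j<length xs.
      (\<forall>i<j. Poly_Mapping.lookup w (xs ! i) = Poly_Mapping.lookup u (xs ! i)) \<and>
      Poly_Mapping.lookup w (xs ! j) < Poly_Mapping.lookup u (xs ! j))}"

definition extremal :: "(real ^ 'n::finite) set \<Rightarrow> bool" where
  "extremal V \<longleftrightarrow> (\<forall>xs ys. variable_ordering xs \<longrightarrow> variable_ordering ys \<longrightarrow>
    Sm (lex_order xs) (vanishing_ideal V) = Sm (lex_order ys) (vanishing_ideal V))"

definition groebner_basis ::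
    "'n monomial rel \<Rightarrow> 'n polynomial set \<Rightarrow> 'n polynomial set \<Rightarrow> bool" where
  "groebner_basis r G I \<longleftrightarrow> finite G \<and> G \<subseteq> I \<and>
    (\<forall>f\<in>I. f \<noteq> 0 \<longrightarrow> (\<exists>g\<in>G. g \<noteq> 0 \<and> monomial_dvd (lm r g) (lm r f)))"

definition universal_groebner_basis :: "'n polynomial set \<Rightarrow> 'n polynomial set \<Rightarrow> bool" where
  "universal_groebner_basis G I \<longleftrightarrow> (\<forall>r. term_order r \<longrightarrow> groebner_basis r G I)"

definition dominating_term :: "'n polynomial \<Rightarrow> 'n monomial \<Rightarrow> bool" where
  "dominating_term f w \<longleftrightarrow> (\<exists>(l::nat) \<alpha> v.
    f = Poly_Mapping.single w 1 + (\<Sum>i=1..l. Poly_Mapping.single (v i) (\<alpha> i)) \<and>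
    (\<forall>i\<in>{1..l}. v i \<noteq> w \<and> monomial_dvd (v i) w))"

definition degree_dominated :: "'n polynomial \<Rightarrow> bool" where
  "degree_dominated f \<longleftrightarrow> (\<exists>w. dominating_term f w)"

end

theory Submission
  imports Defs
begin

text \<open>
  The monomials of a degree dominated polynomial divide its dominating term, which is therefore its
  leading monomial for every term order.  Hence a universal Groebner basis of such polynomials
  yields the same standard monomials for all term orders.

  Conversely, let \<open>S\<close> be the common set of standard monomials of the lexicographic orders.  A nonzero
  element of the ideal cannot be supported in \<open>S\<close>, so a monomial \<open>x\<^sup>w\<close> is congruent to only one
  polynomial supported in \<open>S\<close>, its normal form for all lexicographic orders at once.  The monomials
  of this normal form are therefore at most \<open>x\<^sup>w\<close> in every lexicographic order; the order in which
  \<open>x\<^sub>i\<close> is the largest variable bounds their degree in \<open>x\<^sub>i\<close>, so they divide \<open>x\<^sup>w\<close>.  Subtracting the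
  normal form from \<open>x\<^sup>w\<close>, for each \<open>w\<close> outside \<open>S\<close>, gives degree dominated elements of the ideal, and
  those with all exponents at most \<open>k\<close> suffice because \<open>x\<^sub>i (x\<^sub>i - 1) \<cdots> (x\<^sub>i - k + 1)\<close> vanishes on the
  grid.
\<close>

section \<open>Arithmetic and evaluation of polynomials\<close>

abbreviation poly_scale :: "real \<Rightarrow> 'n polynomial \<Rightarrow> 'n polynomial" where
  "poly_scale c f \<equiv> Poly_Mapping.map ((*) c) f"

lemma lookup_scale [simp]:
  "Poly_Mapping.lookup (poly_scale c f) w = c * Poly_Mapping.lookup f w"
  by (simp add: Poly_Mapping.map.rep_eq when_def)

lemma keys_scale_subset: "Poly_Mapping.keys (poly_scale c f) \<subseteq> Poly_Mapping.keys f"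
  by (auto simp: in_keys_iff)

lemma eval_polynomial_superset:
  assumes "finite A" "Poly_Mapping.keys f \<subseteq> A"
  shows "eval_polynomial f x = (\<Sum>w\<in>A. Poly_Mapping.lookup f w * eval_monomial w x)"
  unfolding eval_polynomial_def
  by (rule sum.mono_neutral_left) (use assms in \<open>auto simp: in_keys_iff\<close>)

lemma eval_polynomial_add:
  "eval_polynomial (f + g) x = eval_polynomial f x + eval_polynomial g x"
proof -
  let ?A = "Poly_Mapping.keys f \<union> Poly_Mapping.keys g"
  have "Poly_Mapping.keys (f + g) \<subseteq> ?A"
    by (rule Poly_Mapping.keys_add)
  then show ?thesis
    by (simp add: eval_polynomial_superset[of ?A] lookup_add distrib_right sum.distrib)
qed

lemma eval_polynomial_scale: "eval_polynomial (poly_scale c f) x = c * eval_polynomial f x"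
  by (simp add: eval_polynomial_superset[of "Poly_Mapping.keys f"] keys_scale_subset
      sum_distrib_left mult.assoc)

lemma eval_polynomial_diff:
  "eval_polynomial (f - g) x = eval_polynomial f x - eval_polynomial g x"
proof -
  have "f - g = f + poly_scale (-1) g"
    by (rule poly_mapping_eqI) (simp add: lookup_add lookup_minus)
  then have "eval_polynomial (f - g) x = eval_polynomial (f + poly_scale (-1) g) x"
    by (rule arg_cong)
  then show ?thesis
    by (simp only: eval_polynomial_add eval_polynomial_scale)
qed

lemma eval_polynomial_zero [simp]: "eval_polynomial 0 x = 0"
  by (simp add: eval_polynomial_def)

lemma eval_polynomial_sum:
  "eval_polynomial (\<Sum>a\<in>A. f a) x = (\<Sum>a\<in>A. eval_polynomial (f a) x)"
  by (induction A rule: infinite_finite_induct) (simp_all add: eval_polynomial_add)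

lemma eval_polynomial_single: "eval_polynomial (Poly_Mapping.single w c) x = c * eval_monomial w x"
  by (simp add: eval_polynomial_superset[of "{w}"])

section \<open>Divisibility and dominating terms\<close>

lemma monomial_dvd_iff:
  "monomial_dvd v w \<longleftrightarrow> (\<forall>i. Poly_Mapping.lookup v i \<le> Poly_Mapping.lookup w i)"
proof
  assume "\<forall>i. Poly_Mapping.lookup v i \<le> Poly_Mapping.lookup w i"
  then have "w = v + (w - v)"
    by (intro poly_mapping_eqI) (simp add: lookup_add lookup_minus)
  then show "monomial_dvd v w"
    unfolding monomial_dvd_def by blast
qed (auto simp: monomial_dvd_def lookup_add)

text \<open>The indexed sum in the definition may repeat a monomial, and its terms may vanish or
  cancel. None of them touches the coefficient at \<open>w\<close>, and every surviving key is some
  \<open>v i\<close> or \<open>w\<close>. Conversely, an enumeration of the keys other than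
  \<open>w\<close> supplies the sum.\<close>

lemma dominating_term_iff:
  "dominating_term f w \<longleftrightarrow>
    Poly_Mapping.lookup f w = 1 \<and> (\<forall>v\<in>Poly_Mapping.keys f. monomial_dvd v w)"
proof
  assume "dominating_term f w"
  then obtain l :: nat and \<alpha> v where
    f: "f = Poly_Mapping.single w 1 + (\<Sum>i=1..l. Poly_Mapping.single (v i) (\<alpha> i))" and
    v: "\<forall>i\<in>{1..l}. v i \<noteq> w \<and> monomial_dvd (v i) w"
    unfolding dominating_term_def by blast
  have "Poly_Mapping.lookup f w = 1"
    using v by (auto simp: f lookup_add lookup_sum lookup_single when_def intro!: sum.neutral)
  moreover have "monomial_dvd u w" if "u \<in> Poly_Mapping.keys f" for u
  proof (cases "u = w")
    case True
    then show ?thesis by (simp add: monomial_dvd_iff)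
  next
    case False
    then have "(\<Sum>i=1..l. Poly_Mapping.lookup (Poly_Mapping.single (v i) (\<alpha> i)) u) \<noteq> 0"
      using that by (simp add: f in_keys_iff lookup_add lookup_sum lookup_single)
    then obtain i where "i \<in> {1..l}" "Poly_Mapping.lookup (Poly_Mapping.single (v i) (\<alpha> i)) u \<noteq> 0"
      by (meson sum.neutral)
    then show ?thesis using v by (auto simp: lookup_single when_def split: if_splits)
  qed
  ultimately show "Poly_Mapping.lookup f w = 1 \<and> (\<forall>v\<in>Poly_Mapping.keys f. monomial_dvd v w)"
    by blast
next
  assume f: "Poly_Mapping.lookup f w = 1 \<and> (\<forall>v\<in>Poly_Mapping.keys f. monomial_dvd v w)"
  let ?A = "Poly_Mapping.keys f - {w}"
  obtain v where v: "bij_betw v {1..card ?A} ?A"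
    using ex_bij_betw_nat_finite_1[of ?A] by auto
  have "f = Poly_Mapping.single w 1 + (\<Sum>u\<in>?A. Poly_Mapping.single u (Poly_Mapping.lookup f u))"
    by (rule poly_mapping_eqI)
      (use f in \<open>auto simp: lookup_add lookup_sum lookup_single when_def in_keys_iff\<close>)
  also have "\<dots> = Poly_Mapping.single w 1 +
      (\<Sum>i=1..card ?A. Poly_Mapping.single (v i) (Poly_Mapping.lookup f (v i)))"
    by (simp only: sum.reindex_bij_betw[OF v,
          of "\<lambda>u. Poly_Mapping.single u (Poly_Mapping.lookup f u)"])
  finally have "f = Poly_Mapping.single w 1 +
      (\<Sum>i=1..card ?A. Poly_Mapping.single (v i) (Poly_Mapping.lookup f (v i)))" .
  moreover have "\<forall>i\<in>{1..card ?A}. v i \<noteq> w \<and> monomial_dvd (v i) w"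
    using f bij_betwE[OF v] by blast
  ultimately show "dominating_term f w"
    unfolding dominating_term_def
    by (intro exI[of _ "card ?A"] exI[of _ "\<lambda>i. Poly_Mapping.lookup f (v i)"] exI[of _ v]) simp
qed

section \<open>Term orders and leading monomials\<close>

lemma term_order_refl: "term_order r \<Longrightarrow> (w, w) \<in> r"
  by (auto simp: term_order_def order_on_defs refl_on_def)

lemma term_order_trans: "term_order r \<Longrightarrow> (u, v) \<in> r \<Longrightarrow> (v, w) \<in> r \<Longrightarrow> (u, w) \<in> r"
  by (auto simp: term_order_def order_on_defs dest: transD)

lemma term_order_antisym: "term_order r \<Longrightarrow> (v, w) \<in> r \<Longrightarrow> (w, v) \<in> r \<Longrightarrow> v = w"
  by (auto simp: term_order_def order_on_defs dest: antisymD)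

lemma term_order_total: "term_order r \<Longrightarrow> (v, w) \<in> r \<or> (w, v) \<in> r"
  by (cases "v = w") (auto simp: term_order_def order_on_defs total_on_def refl_on_def)

text \<open>Minimality of 1 gives \<open>(0, c) \<in> r\<close>, and compatibility translates this
  by \<open>v\<close>.\<close>

lemma monomial_dvd_term_order:
  assumes "term_order r" "monomial_dvd v w"
  shows "(v, w) \<in> r"
proof -
  obtain c where "w = v + c"
    using assms(2) unfolding monomial_dvd_def by blast
  moreover have "(0 + v, c + v) \<in> r"
    using assms(1) unfolding term_order_def by blast
  ultimately show ?thesis by (simp add: add.commute)
qed

lemma lm_eqI:
  assumes "term_order r" "w \<in> Poly_Mapping.keys f" "\<And>v. v \<in> Poly_Mapping.keys f \<Longrightarrow> (v, w) \<in> r"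
  shows "lm r f = w"
  unfolding lm_def by (rule the_equality) (use assms in \<open>auto intro: term_order_antisym\<close>)

lemma finite_term_order_max:
  assumes "term_order r" "finite A" "A \<noteq> {}"
  shows "\<exists>w\<in>A. \<forall>v\<in>A. (v, w) \<in> r"
  using assms(2,3)
proof (induction A rule: finite_ne_induct)
  case (singleton w)
  then show ?case using term_order_refl[OF assms(1)] by simp
next
  case (insert u A)
  then obtain w where "w \<in> A" "\<forall>v\<in>A. (v, w) \<in> r" by blast
  then show ?case
    using term_order_total[OF assms(1), of u w] term_order_refl[OF assms(1)]
      term_order_trans[OF assms(1)] by (metis insert_iff)
qed

lemma
  assumes "term_order r" "f \<noteq> 0"
  shows lm_in_keys: "lm r f \<in> Poly_Mapping.keys f"
    and lm_greatest: "v \<in> Poly_Mapping.keys f \<Longrightarrow> (v, lm r f) \<in> r"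
proof -
  obtain w where "w \<in> Poly_Mapping.keys f" "\<forall>v\<in>Poly_Mapping.keys f. (v, w) \<in> r"
    using finite_term_order_max[OF assms(1), of "Poly_Mapping.keys f"] assms(2) by auto
  moreover from this have "lm r f = w"
    by (intro lm_eqI assms) auto
  ultimately show "lm r f \<in> Poly_Mapping.keys f"
    and "v \<in> Poly_Mapping.keys f \<Longrightarrow> (v, lm r f) \<in> r" by auto
qed

lemma dominating_term_nonzero: "dominating_term f w \<Longrightarrow> f \<noteq> 0"
  by (auto simp: dominating_term_iff)

lemma lm_dominating_term:
  assumes "term_order r" "dominating_term f w"
  shows "lm r f = w"
  using assms
  by (intro lm_eqI) (auto simp: dominating_term_iff in_keys_iff intro: monomial_dvd_term_order)

section \<open>Lexicographic orders\<close>

lemma lex_order_iff_lex: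
  "(w, u) \<in> lex_order xs \<longleftrightarrow>
    w = u \<or> (map (Poly_Mapping.lookup w) xs, map (Poly_Mapping.lookup u) xs) \<in> lex less_than"
  by (auto simp: lex_order_def lexord_lex lexord_take_index_conv list_eq_iff_nth_eq)

text \<open>The exponent lists all have the length of \<open>xs\<close>, and \<open>lex\<close>
  compares only lists of equal length, so it inherits well-foundedness from
  \<open>less_than\<close>.\<close>

lemma wf_lex_order: "wf (lex_order xs - Id)"
  by (rule wf_subset[OF wf_inv_image[OF wf_lex[OF wf_less_than],
        of "\<lambda>w. map (Poly_Mapping.lookup w) xs"]])
    (auto simp: lex_order_iff_lex)

lemma term_order_lex_order:
  fixes xs :: "'n::finite list"
  assumes "variable_ordering xs"
  shows "term_order (lex_order xs)"
proof -
  let ?m = "\<lambda>w :: 'n monomial. map (Poly_Mapping.lookup w) xs"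
  have inj: "w = u" if "?m w = ?m u" for w u
    using that assms by (intro poly_mapping_eqI) (auto simp: variable_ordering_def)
  have "(w, u) \<in> lex_order xs \<or> (u, w) \<in> lex_order xs" for w u
    using lexord_linear[of less_than "?m w" "?m u"] inj[of w u] less_linear
    by (auto simp: lex_order_iff_lex lexord_lex simp del: map_eq_conv)
  then have "total (lex_order xs)"
    by (simp add: total_on_def)
  moreover have "trans (lex_order xs)"
    using lex_transI[OF trans_less_than]
    by (intro transI) (auto simp: lex_order_iff_lex dest: transD)
  moreover have "antisym (lex_order xs)"
    using wf_lex_order[of xs] by (intro antisymI) (auto dest: wf_not_sym)
  moreover have "(0, w) \<in> lex_order xs" for w
  proof (rule ccontr)
    assume *: "(0, w) \<notin> lex_order xs"
    have "(w, 0) \<in> lex_order xs"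
      using * \<open>total (lex_order xs)\<close> unfolding total_on_def by (metis UNIV_I lex_order_iff_lex)
    \<comment> \<open>A strict pair \<open>(w, 0)\<close> would need an exponent below 0, so
      \<open>w = 0\<close>, contrary to the assumption.\<close>
    then show False
      using * by (auto simp: lex_order_def)
  qed
  moreover have "(v + c, w + c) \<in> lex_order xs" if "(v, w) \<in> lex_order xs" for v w c
    using that by (auto simp: lex_order_def lookup_add)
  ultimately show ?thesis
    by (auto simp: term_order_def order_on_defs refl_on_def lex_order_def)
qed

text \<open>Serves to make a prescribed variable the largest one.\<close>

lemma ex_variable_ordering:
  obtains xs where "variable_ordering ((i :: 'n::finite) # xs)"
  using finite_distinct_list[of "UNIV - {i}"] unfolding variable_ordering_def
  by (metis Diff_iff UNIV_I distinct.simps(2) finite insert_Diff list.simps(15) singletonI)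

lemma lex_order_head_le:
  assumes "(v, w) \<in> lex_order (i # xs)"
  shows "Poly_Mapping.lookup v i \<le> Poly_Mapping.lookup w i"
  using assms by (auto simp: lex_order_def)
    (metis le_refl less_imp_le nth_Cons_0 neq0_conv)

section \<open>Normal forms modulo the vanishing ideal\<close>

lemma vanishing_normal_form:
  assumes r: "term_order r" and wf: "wf (r - Id)"
  shows "\<exists>h. Poly_Mapping.keys h \<subseteq> Sm r (vanishing_ideal V) \<and>
    (\<forall>v\<in>Poly_Mapping.keys h. (v, w) \<in> r) \<and> Poly_Mapping.single w 1 - h \<in> vanishing_ideal V"
  using wf
proof (induction w rule: wf_induct_rule)
  case (less w)
  show ?case
  proof (cases "w \<in> Sm r (vanishing_ideal V)")
    case True
    then show ?thesis
      by (intro exI[of _ "Poly_Mapping.single w 1"])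
        (auto simp: vanishing_ideal_def term_order_refl[OF r])
  next
    case False
    \<comment> \<open>All other monomials of \<open>f\<close> are strictly below \<open>w\<close>,
      so the induction hypothesis supplies normal forms for them.\<close>
    then obtain f where f: "f \<in> vanishing_ideal V" "f \<noteq> 0" "lm r f = w"
      by (auto simp: Sm_def)
    define c where "c = Poly_Mapping.lookup f w"
    have w: "w \<in> Poly_Mapping.keys f"
      using lm_in_keys[OF r f(2)] f(3) by simp
    then have c: "c \<noteq> 0"
      by (simp add: c_def in_keys_iff)
    let ?A = "Poly_Mapping.keys f - {w}"
    have A: "(v, w) \<in> r - Id" if "v \<in> ?A" for v
      using lm_greatest[OF r f(2)] f(3) that by auto
    have "\<forall>v\<in>?A. \<exists>h. Poly_Mapping.keys h \<subseteq> Sm r (vanishing_ideal V) \<and>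
        (\<forall>u\<in>Poly_Mapping.keys h. (u, v) \<in> r) \<and> Poly_Mapping.single v 1 - h \<in> vanishing_ideal V"
      using less A by blast
    from bchoice[OF this] obtain h where
      h: "\<And>v. v \<in> ?A \<Longrightarrow> Poly_Mapping.keys (h v) \<subseteq> Sm r (vanishing_ideal V)"
        "\<And>v u. v \<in> ?A \<Longrightarrow> u \<in> Poly_Mapping.keys (h v) \<Longrightarrow> (u, v) \<in> r"
        "\<And>v. v \<in> ?A \<Longrightarrow> Poly_Mapping.single v 1 - h v \<in> vanishing_ideal V"
      by metis
    \<comment> \<open>Solving \<open>f\<close> for x^w expresses it modulo the ideal by the
      remaining monomials, with coefficients \<open>- Poly_Mapping.lookup f v / c\<close>; each x^v
      is then replaced by its normal form \<open>h v\<close>.\<close>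
    define H where "H = (\<Sum>v\<in>?A. poly_scale (- Poly_Mapping.lookup f v / c) (h v))"
    have H: "\<exists>v\<in>?A. u \<in> Poly_Mapping.keys (h v)" if u: "u \<in> Poly_Mapping.keys H" for u
    proof (rule ccontr)
      assume "\<not> ?thesis"
      then have "Poly_Mapping.lookup H u = 0"
        by (auto simp: H_def lookup_sum in_keys_iff intro!: sum.neutral)
      then show False using u by (simp add: in_keys_iff)
    qed
    have "Poly_Mapping.keys H \<subseteq> Sm r (vanishing_ideal V)"
      using H h(1) by blast
    moreover have "(u, w) \<in> r" if "u \<in> Poly_Mapping.keys H" for u
      using H[OF that] h(2) A term_order_trans[OF r] by blast
    moreover have "eval_polynomial (Poly_Mapping.single w 1 - H) x = 0" if x: "x \<in> V" for x
    proof -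
      have "eval_polynomial (h v) x = eval_monomial v x" if "v \<in> ?A" for v
        using h(3)[OF that] x
        by (simp add: vanishing_ideal_def eval_polynomial_diff eval_polynomial_single)
      then have "eval_polynomial H x = (\<Sum>v\<in>?A. - Poly_Mapping.lookup f v / c * eval_monomial v x)"
        by (simp add: H_def eval_polynomial_sum eval_polynomial_scale)
      then have "c * eval_polynomial H x = - (\<Sum>v\<in>?A. Poly_Mapping.lookup f v * eval_monomial v x)"
        using c by (simp add: sum_distrib_left sum_negf)
      moreover have "c * eval_monomial w x + (\<Sum>v\<in>?A. Poly_Mapping.lookup f v * eval_monomial v x) = 0"
        using f(1) x w
        by (simp add: vanishing_ideal_def eval_polynomial_def c_def sum.remove[of _ w])
      ultimately have "c * (eval_monomial w x - eval_polynomial H x) = 0"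
        by (simp add: algebra_simps)
      then show ?thesis
        using c by (simp add: eval_polynomial_diff eval_polynomial_single)
    qed
    ultimately show ?thesis
      by (intro exI[of _ H]) (auto simp: vanishing_ideal_def)
  qed
qed

text \<open>The leading monomial of a nonzero such \<open>f\<close> would be one of its keys, hence
  standard, and yet a leading monomial of an element of \<open>I\<close>.\<close>

lemma Sm_supported_zero:
  assumes "term_order r" "f \<in> I" "Poly_Mapping.keys f \<subseteq> Sm r I"
  shows "f = 0"
  using assms lm_in_keys[OF assms(1)] by (fastforce simp: Sm_def)

text \<open>The bound on the keys ensures that subtracting a multiple of \<open>f\<close> to cancel
  x^w creates no further nonstandard monomial.\<close>

lemma extremal_dominating_term:
  fixes V :: "(real ^ 'n::finite) set"
  assumes V: "extremal V" and xs: "variable_ordering xs"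
    and w: "w \<notin> Sm (lex_order xs) (vanishing_ideal V)"
  obtains f where "f \<in> vanishing_ideal V" "dominating_term f w"
    "Poly_Mapping.keys f \<subseteq> insert w (Sm (lex_order xs) (vanishing_ideal V))"
proof -
  let ?S = "Sm (lex_order xs) (vanishing_ideal V)"
  obtain h where h: "Poly_Mapping.keys h \<subseteq> ?S"
    "Poly_Mapping.single w 1 - h \<in> vanishing_ideal V"
    using vanishing_normal_form[OF term_order_lex_order[OF xs] wf_lex_order] by blast
  have le: "Poly_Mapping.lookup v i \<le> Poly_Mapping.lookup w i" if v: "v \<in> Poly_Mapping.keys h" for v i
  proof -
    \<comment> \<open>With x_i largest, the normal form \<open>h'\<close> obtained below has degree
      in x_i at most that of x^w. Uniqueness gives \<open>h = h'\<close>, so the bound passes to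
      \<open>h\<close>.\<close>
    obtain ys where ys: "variable_ordering (i # ys)"
      by (rule ex_variable_ordering)
    then have S: "Sm (lex_order (i # ys)) (vanishing_ideal V) = ?S"
      using V xs unfolding extremal_def by blast
    obtain h' where h': "Poly_Mapping.keys h' \<subseteq> ?S"
      "\<forall>v\<in>Poly_Mapping.keys h'. (v, w) \<in> lex_order (i # ys)"
      "Poly_Mapping.single w 1 - h' \<in> vanishing_ideal V"
      using vanishing_normal_form[OF term_order_lex_order[OF ys] wf_lex_order] S by metis
    have "h - h' \<in> vanishing_ideal V"
      using h(2) h'(3) by (auto simp: vanishing_ideal_def eval_polynomial_diff)
    moreover have "Poly_Mapping.keys (h - h') \<subseteq> ?S"
      using h(1) h'(1) Poly_Mapping.keys_diff[of h h'] by blast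
    ultimately have "h - h' = 0"
      using Sm_supported_zero term_order_lex_order[OF xs] by blast
    then have "(v, w) \<in> lex_order (i # ys)"
      using h'(2) v by simp
    then show ?thesis by (rule lex_order_head_le)
  qed
  have "w \<notin> Poly_Mapping.keys h"
    using h(1) w by blast
  then have "dominating_term (Poly_Mapping.single w 1 - h) w"
    using le by (auto simp: dominating_term_iff in_keys_iff lookup_minus lookup_single monomial_dvd_iff
        when_def split: if_splits)
  moreover have "Poly_Mapping.keys (Poly_Mapping.single w 1 - h) \<subseteq> insert w ?S"
    using h(1) Poly_Mapping.keys_diff[of "Poly_Mapping.single w 1" h] by auto
  ultimately show thesis
    using that h(2) by blast
qed

section \<open>Elements of the ideal with prescribed dominating terms\<close>

lemma grid_dominating_term:
  fixes V :: "(real ^ 'n::finite) set"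
  assumes "V \<subseteq> {x. x $ i \<in> real ` {..<k}}"
  obtains f where "f \<in> vanishing_ideal V" "dominating_term f (Poly_Mapping.single i k)"
proof -
  \<comment> \<open>The roots of \<open>p\<close> are the admissible values of the i-th coordinate.
    Below, \<open>f\<close> is \<open>p\<close> in the variable x_i; as \<open>p\<close> is monic of
    degree \<open>k\<close>, the term x_i^k dominates.\<close>
  define p :: "real poly" where "p = (\<Prod>j<k. [:- real j, 1:])"
  have deg: "degree p = k"
    by (simp add: p_def degree_prod_eq_sum_degree)
  have lead: "coeff p k = 1"
    using lead_coeff_prod[of "\<lambda>j. [:- real j, 1:]" "{..<k}"] deg by (simp add: p_def)
  define f where "f = (\<Sum>m\<le>k. Poly_Mapping.single (Poly_Mapping.single i m) (coeff p m))"
  have mono: "eval_monomial (Poly_Mapping.single i m) x = x $ i ^ m" for m and x :: "real ^ 'n"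
    unfolding eval_monomial_def lookup_single when_def
    by (subst prod.remove[of _ i]) (auto intro!: prod.neutral)
  have "eval_polynomial f x = poly p (x $ i)" for x
    by (simp add: f_def eval_polynomial_sum eval_polynomial_single mono poly_altdef deg)
  then have "f \<in> vanishing_ideal V"
    using assms by (auto simp: vanishing_ideal_def p_def poly_prod)
  \<comment> \<open>Injectivity ensures that only the summand \<open>m = k\<close> contributes to
    the coefficient at x_i^k.\<close>
  moreover have "inj (Poly_Mapping.single i :: nat \<Rightarrow> 'n monomial)"
    by (rule injI) (metis lookup_single_eq)
  then have "Poly_Mapping.lookup f (Poly_Mapping.single i k) = 1"
    by (simp add: f_def lookup_sum lookup_single when_def inj_eq lead)
  moreover have "monomial_dvd v (Poly_Mapping.single i k)" if v: "v \<in> Poly_Mapping.keys f" for v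
  proof -
    have "(\<Sum>m\<le>k. Poly_Mapping.lookup (Poly_Mapping.single (Poly_Mapping.single i m) (coeff p m)) v) \<noteq> 0"
      using v by (simp add: f_def lookup_sum in_keys_iff)
    then obtain m where "m \<le> k"
      "Poly_Mapping.lookup (Poly_Mapping.single (Poly_Mapping.single i m) (coeff p m)) v \<noteq> 0"
      by (meson atMost_iff sum.neutral)
    then show ?thesis
      by (auto simp: lookup_single when_def monomial_dvd_iff split: if_splits)
  qed
  ultimately show thesis
    using that by (auto simp: dominating_term_iff)
qed

lemma finite_bounded_monomials:
  "finite {w :: 'n::finite monomial. \<forall>i. Poly_Mapping.lookup w i \<le> k}"
proof (rule finite_imageD)
  show "finite (Poly_Mapping.lookup ` {w :: 'n monomial. \<forall>i. Poly_Mapping.lookup w i \<le> k})"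
    by (rule finite_subset[OF _ finite_PiE[of "UNIV :: 'n set" "\<lambda>_. {..k}"]]) auto
qed (simp add: inj_on_def lookup_inject)

text \<open>Here \<open>f\<close> is the product of x^c and \<open>g\<close>, written as a shift of
  exponents. It makes every multiple of a dominating term a leading monomial of the ideal for all
  term orders at once.\<close>

lemma vanishing_ideal_dominating_term_mult:
  assumes g: "g \<in> vanishing_ideal V" "dominating_term g w"
  obtains f where "f \<in> vanishing_ideal V" "dominating_term f (w + c)"
proof -
  define f where
    "f = (\<Sum>v\<in>Poly_Mapping.keys g. Poly_Mapping.single (v + c) (Poly_Mapping.lookup g v))"
  have "eval_monomial (v + c) x = eval_monomial v x * eval_monomial c x" for v x
    by (simp add: eval_monomial_def lookup_add power_add prod.distrib)
  then have "eval_polynomial f x = eval_polynomial g x * eval_monomial c x" for x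
    by (simp add: f_def eval_polynomial_sum eval_polynomial_single eval_polynomial_def[of g]
        sum_distrib_right mult.assoc)
  then have "f \<in> vanishing_ideal V"
    using g(1) by (simp add: vanishing_ideal_def)
  moreover have lookup: "Poly_Mapping.lookup f (v + c) = Poly_Mapping.lookup g v" for v
    by (simp add: f_def lookup_sum lookup_single when_def in_keys_iff)
  moreover have "monomial_dvd u (w + c)" if u: "u \<in> Poly_Mapping.keys f" for u
  proof -
    have "Poly_Mapping.lookup f u \<noteq> 0"
      using u by (simp add: in_keys_iff)
    then obtain v where "v \<in> Poly_Mapping.keys g"
      "Poly_Mapping.lookup (Poly_Mapping.single (v + c) (Poly_Mapping.lookup g v)) u \<noteq> 0"
      unfolding f_def lookup_sum by (meson sum.neutral)
    then show ?thesis
      using g(2) by (auto simp: dominating_term_iff monomial_dvd_iff lookup_add lookup_single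
          when_def split: if_splits)
  qed
  ultimately show thesis
    using that g(2) by (simp add: dominating_term_iff)
qed

theorem theorem4:
  fixes k :: nat and V :: "(real ^ 'n::finite) set"
  assumes "k \<ge> 1"
    and "finite V"
    and "V \<subseteq> {x. \<forall>i. x $ i \<in> real ` {0..k - 1}}"
  shows "extremal V \<longleftrightarrow>
    (\<exists>G :: 'n polynomial set. finite G \<and> (\<forall>g\<in>G. degree_dominated g) \<and>
      universal_groebner_basis G (vanishing_ideal V))"
proof

  \<comment> \<open>From extremality to a universal Groebner basis\<close>
  let ?I = "vanishing_ideal V"
  assume V: "extremal V"
  obtain xs :: "'n list" where xs: "variable_ordering xs"
    using ex_variable_ordering by blast
  define S where "S = Sm (lex_order xs) ?I"
  have "\<exists>f. f \<in> ?I \<and> dominating_term f w \<and> Poly_Mapping.keys f \<subseteq> insert w S" if "w \<notin> S" for w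
    using extremal_dominating_term[OF V xs] that unfolding S_def by metis
  then obtain F where F: "\<And>w. w \<notin> S \<Longrightarrow> F w \<in> ?I" "\<And>w. w \<notin> S \<Longrightarrow> dominating_term (F w) w"
    "\<And>w. w \<notin> S \<Longrightarrow> Poly_Mapping.keys (F w) \<subseteq> insert w S"
    by metis
  have power: "Poly_Mapping.single i k \<notin> S" for i
  proof -
    \<comment> \<open>For \<open>k = 0\<close>, truncated subtraction would leave 0 in the set on
      the left.\<close>
    have "{0..k - 1} = {..<k}" using assms(1) by auto
    then have "V \<subseteq> {x. x $ i \<in> real ` {..<k}}" using assms(3) by auto
    then obtain f where "f \<in> ?I" "dominating_term f (Poly_Mapping.single i k)"
      by (rule grid_dominating_term)
    then show ?thesis
      using lm_dominating_term[OF term_order_lex_order[OF xs]] dominating_term_nonzero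
      by (fastforce simp: S_def Sm_def)
  qed
  \<comment> \<open>The bound is \<open>k\<close> and not \<open>k - 1\<close>, so that
    \<open>M\<close> contains every x_i^k; these divide the monomials having some exponent above
    \<open>k\<close>.\<close>
  define M where "M = {w. w \<notin> S \<and> (\<forall>i. Poly_Mapping.lookup w i \<le> k)}"
  have M: "\<exists>v\<in>M. monomial_dvd v w" if w: "w \<notin> S" for w
  proof (cases "\<forall>i. Poly_Mapping.lookup w i \<le> k")
    case True
    then show ?thesis using w by (auto simp: M_def monomial_dvd_iff)
  next
    case False
    then obtain i where "k < Poly_Mapping.lookup w i" by (auto simp: not_le)
    then have "Poly_Mapping.single i k \<in> M" "monomial_dvd (Poly_Mapping.single i k) w"
      using power by (auto simp: M_def monomial_dvd_iff lookup_single when_def)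
    then show ?thesis by blast
  qed
  have fin: "finite (F ` M)"
    unfolding M_def by (intro finite_imageI finite_subset[OF _ finite_bounded_monomials]) auto
  have lm_notin: "lm r f \<notin> S" if r: "term_order r" and f: "f \<in> ?I" "f \<noteq> 0" for r f
  proof
    \<comment> \<open>Reducing the monomials outside \<open>S\<close> gives an element supported in \<open>S\<close>, that is \<open>0\<close>, but leaves
      the coefficient at the leading monomial unchanged.\<close>
    assume s: "lm r f \<in> S"
    let ?A = "Poly_Mapping.keys f - S"
    define g where "g = f - (\<Sum>w\<in>?A. poly_scale (Poly_Mapping.lookup f w) (F w))"
    have coeff: "Poly_Mapping.lookup g u = Poly_Mapping.lookup f u -
        (\<Sum>w\<in>?A. Poly_Mapping.lookup f w * Poly_Mapping.lookup (F w) u)" for u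
      by (simp add: g_def lookup_minus lookup_sum)
    have "g \<in> ?I"
      using f F(1)
      by (auto simp: g_def vanishing_ideal_def eval_polynomial_diff eval_polynomial_sum
          eval_polynomial_scale intro!: sum.neutral)
    moreover have "Poly_Mapping.keys g \<subseteq> S"
    proof
      fix u
      assume u: "u \<in> Poly_Mapping.keys g"
      show "u \<in> S"
      proof (rule ccontr)
        assume uS: "u \<notin> S"
        \<comment> \<open>Outside \<open>S\<close>, the only key of \<open>F w\<close> is
          \<open>w\<close>, with coefficient 1. Hence a single subtraction clears all monomials
          outside \<open>S\<close>.\<close>
        have "Poly_Mapping.lookup (F w) u = (1 when w = u)" if "w \<in> ?A" for w
          using F(2,3)[of w] that uS by (auto simp: dominating_term_iff in_keys_iff when_def)
        then have "(\<Sum>w\<in>?A. Poly_Mapping.lookup f w * Poly_Mapping.lookup (F w) u) =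
            (\<Sum>w\<in>?A. if w = u then Poly_Mapping.lookup f w else 0)"
          by (intro sum.cong) (auto simp: when_def)
        also have "\<dots> = Poly_Mapping.lookup f u"
          using uS by (auto simp: in_keys_iff)
        finally show False using u coeff[of u] by (simp add: in_keys_iff)
      qed
    qed
    ultimately have "g = 0"
      using Sm_supported_zero[OF term_order_lex_order[OF xs]] unfolding S_def by blast
    \<comment> \<open>Divisibility carries the argument over to an arbitrary \<open>r\<close>: if
      \<open>lm r f\<close> occurred in \<open>F w\<close>, it would divide \<open>w\<close>, a key
      of \<open>f\<close>. Both would then be equal, although only \<open>lm r f\<close> lies in
      \<open>S\<close>.\<close>
    moreover have "Poly_Mapping.lookup (F w) (lm r f) = 0" if w: "w \<in> ?A" for w
    proof (rule ccontr)
      assume "Poly_Mapping.lookup (F w) (lm r f) \<noteq> 0"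
      then have "(lm r f, w) \<in> r"
        using F(2)[of w] w
        by (auto simp: dominating_term_iff in_keys_iff intro!: monomial_dvd_term_order[OF r])
      moreover have "(w, lm r f) \<in> r"
        using w by (intro lm_greatest[OF r f(2)]) auto
      ultimately show False
        using term_order_antisym[OF r] s w by blast
    qed
    then have "Poly_Mapping.lookup g (lm r f) = Poly_Mapping.lookup f (lm r f)"
      by (simp add: coeff)
    ultimately show False
      using lm_in_keys[OF r f(2)] by (simp add: in_keys_iff)
  qed
  have "groebner_basis r (F ` M) ?I" if r: "term_order r" for r
    unfolding groebner_basis_def
  proof (intro conjI ballI impI)
    fix f
    assume "f \<in> ?I" "f \<noteq> 0"
    then obtain v where v: "v \<in> M" "monomial_dvd v (lm r f)"
      using M lm_notin[OF r] by blast
    then have "dominating_term (F v) v"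
      using F(2) by (simp add: M_def)
    then have "F v \<noteq> 0" "lm r (F v) = v"
      using r by (simp_all add: dominating_term_nonzero lm_dominating_term)
    then show "\<exists>g\<in>F ` M. g \<noteq> 0 \<and> monomial_dvd (lm r g) (lm r f)"
      using v by (intro bexI[of _ "F v"]) simp_all
  qed (use fin F(1) in \<open>auto simp: M_def\<close>)
  moreover have "\<forall>g\<in>F ` M. degree_dominated g"
    using F(2) by (auto simp: M_def degree_dominated_def)
  ultimately show "\<exists>G :: 'n polynomial set. finite G \<and> (\<forall>g\<in>G. degree_dominated g) \<and>
      universal_groebner_basis G ?I"
    using fin unfolding universal_groebner_basis_def by blast
next

  \<comment> \<open>From a universal Groebner basis to extremality\<close>
  let ?I = "vanishing_ideal V"
  assume "\<exists>G :: 'n polynomial set. finite G \<and> (\<forall>g\<in>G. degree_dominated g) \<and>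
      universal_groebner_basis G ?I"
  then obtain G where G: "\<And>g. g \<in> G \<Longrightarrow> \<exists>w. dominating_term g w"
    "\<And>r. term_order r \<Longrightarrow> groebner_basis r G ?I"
    unfolding degree_dominated_def universal_groebner_basis_def by blast
  \<comment> \<open>Both orders are arbitrary, so exchanging them turns the inclusion into
    equality.\<close>
  have "Sm r ?I \<subseteq> Sm r' ?I" if r: "term_order r" "term_order r'" for r r'
  proof
    fix w
    assume w: "w \<in> Sm r ?I"
    show "w \<in> Sm r' ?I"
    proof (rule ccontr)
      assume "w \<notin> Sm r' ?I"
      then obtain f where f: "f \<in> ?I" "f \<noteq> 0" "lm r' f = w"
        by (auto simp: Sm_def)
      then obtain g where g: "g \<in> G" "g \<in> ?I" "monomial_dvd (lm r' g) w"
        using G(2)[OF r(2)] unfolding groebner_basis_def by blast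
      obtain v where v: "dominating_term g v"
        using G(1)[OF g(1)] by blast
      \<comment> \<open>The leading monomial of \<open>g\<close> is \<open>v\<close> for
        \<open>r'\<close> and for \<open>r\<close> alike; a multiple of \<open>g\<close> thus has
        leading monomial \<open>w\<close> also for \<open>r\<close>.\<close>
      then obtain c where "w = v + c"
        using g(3) lm_dominating_term[OF r(2)] unfolding monomial_dvd_def by blast
      then obtain f' where "f' \<in> ?I" "dominating_term f' w"
        using vanishing_ideal_dominating_term_mult[OF g(2) v] by blast
      then show False
        using w lm_dominating_term[OF r(1)] dominating_term_nonzero unfolding Sm_def by blast
    qed
  qed
  then show "extremal V"
    unfolding extremal_def using term_order_lex_order by (meson subset_antisym)
qed

end
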